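(* Let $\mathcal{N}$ be a finite ground set, $f:2^{\mathcal{N}}\to\mathbb{R}_{\ge 0}$ a non-negative (not necessarily monotone) submodular function, $(\mathcal{N},\mathcal{I})$ a $k$-system, and $O\in\arg\max\{f(S):S\in\mathcal{I}\}$. For any integer $\ell\ge 2$ and any $p\in(0,1]$, the algorithm \textsc{RandomMultiGreedy}$(\ell,p)$ (described in the context) outputs a set $S^*\in\mathcal{I}$ satisfying $$f(O)\le\frac{\ell\,(k+\frac{\ell}{p}-1)}{\ell-p}\,\mathbb{E}[f(S^* )].$$
   Context: Notation: $f(u\mid Y)=f(Y\cup\{u\})-f(Y)$. An independence system $(\mathcal{N},\mathcal{I})$ is a down-closed family $\mathcal{I}\subseteq 2^{\mathcal{N}}$ with $\emptyset\in\mathcal{I}$; for $X\subseteq Y$, $X$ is a base of $Y$ if $X\in\mathcal{I}$ and $X\cup\{u\}\notin\mathcal{I}$ for all $u\in Y\setminus X$; it is a $k$-system ($k\ge 1$) if any two bases $X_1,X_2$ of any $Y\subseteq\mathcal{N}$ satisfy $|X_1|\le k|X_2|$. Algorithm \textsc{RandomMultiGreedy}$(\ell,p)$: initialize $S_1=\dots=S_\ell=\emptyset$ and a pool $P=\mathcal{N}$. Repeat: for each $i\in[\ell]$ let $A_i=\{u\in P: S_i\cup\{u\}\in\mathcal{I}\}$ and $v_i\in\arg\max_{u\in A_i} f(u\mid S_i)$; if all $A_i$ are empty, stop; otherwise let $i^\circ\in\arg\max_{i: A_i\neq\emptyset} f(v_i\mid S_i)$ and $u=v_{i^\circ}$; if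 $f(u\mid S_{i^\circ})\le 0$, stop; otherwise, with probability $p$ (independently) add $u$ to $S_{i^\circ}$ (with probability $1-p$ discard it), and remove $u$ from $P$; also stop when $P=\emptyset$. Output $S^*\in\arg\max_{S\in\{S_1,\dots,S_\ell\}}f(S)$. The expectation is over the algorithm's internal randomness. *)

theory Defs
  imports "HOL-Probability.Probability"
begin

definition submodular_on :: "'a set \<Rightarrow> ('a set \<Rightarrow> real) \<Rightarrow> bool" where
  "submodular_on N f \<longleftrightarrow>
     (\<forall>X Y. X \<subseteq> N \<longrightarrow> Y \<subseteq> N \<longrightarrow> f (X \<union> Y) + f (X \<inter> Y) \<le> f X + f Y)"

definition independence_system :: "'a set \<Rightarrow> 'a set set \<Rightarrow> bool" where
  "independence_system N \<I> \<longleftrightarrow>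
     \<I> \<subseteq> Pow N \<and> {} \<in> \<I> \<and> (\<forall>Y\<in>\<I>. \<forall>X. X \<subseteq> Y \<longrightarrow> X \<in> \<I>)"

definition base_of :: "'a set set \<Rightarrow> 'a set \<Rightarrow> 'a set \<Rightarrow> bool" where
  "base_of \<I> X Y \<longleftrightarrow> X \<subseteq> Y \<and> X \<in> \<I> \<and> (\<forall>u\<in>Y - X. X \<union> {u} \<notin> \<I>)"

definition k_system :: "'a set \<Rightarrow> 'a set set \<Rightarrow> real \<Rightarrow> bool" where
  "k_system N \<I> k \<longleftrightarrow> independence_system N \<I> \<and> 1 \<le> k \<and>
     (\<forall>Y X1 X2. Y \<subseteq> N \<longrightarrow> base_of \<I> X1 Y \<longrightarrow> base_of \<I> X2 Y \<longrightarrow>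
        real (card X1) \<le> k * real (card X2))"

definition marginal :: "('a set \<Rightarrow> real) \<Rightarrow> 'a \<Rightarrow> 'a set \<Rightarrow> real" where
  "marginal f u Y = f (Y \<union> {u}) - f Y"

definition candidates :: "'a set set \<Rightarrow> 'a set \<Rightarrow> 'a set \<Rightarrow> 'a set" where
  "candidates \<I> P X = {u \<in> P. X \<union> {u} \<in> \<I>}"

text \<open>The pair \<open>(i, u)\<close> is an admissible choice of the index and the element to be considered in
  one iteration, for some way of breaking ties in the two maximisations.\<close>

definition greedy_choice ::
    "('a set \<Rightarrow> real) \<Rightarrow> 'a set set \<Rightarrow> nat \<Rightarrow> (nat \<Rightarrow> 'a set) \<Rightarrow> 'a set \<Rightarrow> nat \<Rightarrow> 'a \<Rightarrow> bool" where
  "greedy_choice f \<I> l S P i u \<longleftrightarrow> (\<exists>v.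
     (\<forall>j\<in>{1..l}. candidates \<I> P (S j) \<noteq> {} \<longrightarrow>
        is_arg_max (\<lambda>w. marginal f w (S j)) (\<lambda>w. w \<in> candidates \<I> P (S j)) (v j)) \<and>
     is_arg_max (\<lambda>j. marginal f (v j) (S j))
       (\<lambda>j. j \<in> {1..l} \<and> candidates \<I> P (S j) \<noteq> {}) i \<and>
     u = v i)"

definition best_solution :: "('a set \<Rightarrow> real) \<Rightarrow> nat \<Rightarrow> (nat \<Rightarrow> 'a set) \<Rightarrow> 'a set \<Rightarrow> bool" where
  "best_solution f l S X \<longleftrightarrow> is_arg_max f (\<lambda>Y. Y \<in> S ` {1..l}) X"

text \<open>\<open>rmg_from f \<I> l p S P D\<close>: when the main loop is entered with solutions \<open>S 1, \<dots>, S l\<close> and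
  pool \<open>P\<close>, the output \<open>S\<^sup>*\<close> may have distribution \<open>D\<close>.  The relation is not functional because
  every maximiser may be chosen arbitrarily; as the two premises about \<open>D1\<close> and \<open>D0\<close> in the last rule
  are independent, ties may be broken differently depending on the outcomes of earlier coin flips.\<close>

inductive rmg_from ::
    "('a set \<Rightarrow> real) \<Rightarrow> 'a set set \<Rightarrow> nat \<Rightarrow> real \<Rightarrow>
     (nat \<Rightarrow> 'a set) \<Rightarrow> 'a set \<Rightarrow> 'a set pmf \<Rightarrow> bool"
  for f :: "'a set \<Rightarrow> real" and \<I> :: "'a set set" and l :: nat and p :: real
where
  stop_pool:
    "\<lbrakk>P = {}; best_solution f l S X\<rbrakk> \<Longrightarrow> rmg_from f \<I> l p S P (return_pmf X)"
| stop_infeasible: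
    "\<lbrakk>\<forall>i\<in>{1..l}. candidates \<I> P (S i) = {}; best_solution f l S X\<rbrakk>
     \<Longrightarrow> rmg_from f \<I> l p S P (return_pmf X)"
| stop_gain:
    "\<lbrakk>greedy_choice f \<I> l S P i u; marginal f u (S i) \<le> 0; best_solution f l S X\<rbrakk>
     \<Longrightarrow> rmg_from f \<I> l p S P (return_pmf X)"
| step:
    "\<lbrakk>greedy_choice f \<I> l S P i u; marginal f u (S i) > 0;
      rmg_from f \<I> l p (S(i := S i \<union> {u})) (P - {u}) D1;
      rmg_from f \<I> l p S (P - {u}) D0\<rbrakk>
     \<Longrightarrow> rmg_from f \<I> l p S P (bind_pmf (bernoulli_pmf p) (\<lambda>b. if b then D1 else D0))"

definition random_multi_greedy ::
    "'a set \<Rightarrow> ('a set \<Rightarrow> real) \<Rightarrow> 'a set set \<Rightarrow> nat \<Rightarrow> real \<Rightarrow> 'a set pmf \<Rightarrow> bool" where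
  "random_multi_greedy N f \<I> l p D \<longleftrightarrow> rmg_from f \<I> l p (\<lambda>i. {}) N D"

text \<open>The algorithm always terminates with some output distribution.\<close>

lemma ex_is_arg_max_finite:
  fixes g :: "'b \<Rightarrow> real"
  assumes "finite A" "A \<noteq> {}"
  shows "\<exists>x. is_arg_max g (\<lambda>x. x \<in> A) x"
  using ex_is_arg_min_if_finite[OF assms, of "\<lambda>x. - g x"]
  by (auto simp: is_arg_min_def is_arg_max_def)

lemma ex_rmg_from:
  assumes "finite P" "1 \<le> l"
  shows "\<exists>D. rmg_from f \<I> l p S P D"
  using assms(1)
proof (induction "card P" arbitrary: P S rule: less_induct)
  case less
  have "\<exists>X. best_solution f l S X"
    unfolding best_solution_def using assms(2) by (intro ex_is_arg_max_finite) auto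
  then obtain X where X: "best_solution f l S X" by blast
  show ?case
  proof (cases "\<forall>i\<in>{1..l}. candidates \<I> P (S i) = {}")
    case True
    then show ?thesis using X rmg_from.stop_infeasible by blast
  next
    case False
    have fin: "finite (candidates \<I> P (S j))" for j
      using less.prems by (simp add: candidates_def)
    have "\<forall>j. \<exists>w. candidates \<I> P (S j) \<noteq> {} \<longrightarrow>
        is_arg_max (\<lambda>w. marginal f w (S j)) (\<lambda>w. w \<in> candidates \<I> P (S j)) w"
      using ex_is_arg_max_finite[OF fin] by blast
    then obtain v where v: "\<And>j. candidates \<I> P (S j) \<noteq> {} \<Longrightarrow>
        is_arg_max (\<lambda>w. marginal f w (S j)) (\<lambda>w. w \<in> candidates \<I> P (S j)) (v j)"
      by metis
    have "\<exists>i. is_arg_max (\<lambda>j. marginal f (v j) (S j))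
        (\<lambda>j. j \<in> {j \<in> {1..l}. candidates \<I> P (S j) \<noteq> {}}) i"
      using False by (intro ex_is_arg_max_finite) auto
    then obtain i where i: "is_arg_max (\<lambda>j. marginal f (v j) (S j))
        (\<lambda>j. j \<in> {1..l} \<and> candidates \<I> P (S j) \<noteq> {}) i"
      by auto
    have g: "greedy_choice f \<I> l S P i (v i)"
      unfolding greedy_choice_def using v i by blast
    have "v i \<in> P"
      using v[of i] i by (auto simp: is_arg_max_def candidates_def)
    then have "card (P - {v i}) < card P"
      using less.prems by (meson card_Diff1_less)
    then have IH: "\<exists>D. rmg_from f \<I> l p S' (P - {v i}) D" for S'
      using less.hyps less.prems by blast
    show ?thesis
    proof (cases "marginal f (v i) (S i) \<le> 0")
      case True
      then show ?thesis using rmg_from.stop_gain[OF g _ X] by blast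
    next
      case False
      then show ?thesis
        using rmg_from.step[OF g] IH by (meson not_le)
    qed
  qed
qed

lemma ex_random_multi_greedy:
  "finite N \<Longrightarrow> 1 \<le> l \<Longrightarrow> \<exists>D. random_multi_greedy N f \<I> l p D"
  unfolding random_multi_greedy_def by (rule ex_rmg_from)

end

theory Submission
  imports Defs
begin

text \<open>
  Let \<open>O\<close> be the optimum and \<open>R = S\<^sub>1 \<union> \<dots> \<union> S\<^sub>l\<close>. Disjointness of the \<open>S\<^sub>i\<close> and submodularity give
  \<open>\<Sum> f (O \<union> S\<^sub>i) \<ge> (l - 1) f O + f (O \<union> R)\<close>, and as every element enters \<open>R\<close> with probability at
  most \<open>p\<close>, the last term is at least \<open>(1 - p) f O\<close> in expectation.

  Conversely \<open>f (O \<union> S\<^sub>i) - f S\<^sub>i\<close> is at most the sum of the marginals of the \<open>w \<in> O - S\<^sub>i\<close>. If \<open>w\<close> was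
  considered while it still fitted into \<open>S\<^sub>i\<close>, its marginal is at most the gain at that moment; if some
  addition to \<open>S\<^sub>i\<close> blocked it before, its marginal is at most the gain of that addition; otherwise it is
  nonpositive when the algorithm stops. By the \<open>k\<close>-system property and the monotonicity of the gains,
  the blocked elements together with the gains of \<open>O \<inter> S\<^sub>i\<close> cost at most \<open>k (f S\<^sub>i - f {})\<close>. The
  considered elements of \<open>O\<close> thus cost \<open>l - 2\<close> times their gain when added and \<open>l\<close> times when discarded,
  on average \<open>l - 2 p\<close> times, against an expected increase of \<open>p\<close> times the gain in \<open>\<Sum> f S\<^sub>i\<close>. Hence
  \<open>(l - p) f O \<le> (k + 1 + (l / p - 2)) E[\<Sum> f S\<^sub>i]\<close>.
\<close>

lemma submodular_onD:
  assumes "submodular_on N f" "X \<subseteq> N" "Y \<subseteq> N"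
  shows "f (X \<union> Y) + f (X \<inter> Y) \<le> f X + f Y"
  using assms by (auto simp: submodular_on_def)

lemma marginal_antimono:
  assumes "submodular_on N f" "X \<subseteq> Y" "Y \<subseteq> N" "u \<in> N - Y"
  shows "marginal f u Y \<le> marginal f u X"
proof -
  have "f ((X \<union> {u}) \<union> Y) + f ((X \<union> {u}) \<inter> Y) \<le> f (X \<union> {u}) + f Y"
    using assms by (intro submodular_onD[OF assms(1)]) auto
  moreover have "(X \<union> {u}) \<union> Y = Y \<union> {u}" "(X \<union> {u}) \<inter> Y = X"
    using assms by auto
  ultimately show ?thesis by (simp add: marginal_def)
qed

lemma union_gain_le_sum_marginal:
  assumes "submodular_on N f" "finite A" "A \<subseteq> N" "X \<subseteq> N" "A \<inter> X = {}"
  shows "f (X \<union> A) - f X \<le> (\<Sum>w\<in>A. marginal f w X)"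
  using assms(2,3,5)
proof (induction A rule: finite_induct)
  case empty
  then show ?case by simp
next
  case (insert u A)
  have "marginal f u (X \<union> A) \<le> marginal f u X"
    using insert assms by (intro marginal_antimono[OF assms(1)]) auto
  moreover have "f (X \<union> insert u A) = f (X \<union> A) + marginal f u (X \<union> A)"
    by (simp add: marginal_def)
  ultimately show ?case using insert by simp
qed

lemma submodular_disjoint_family:
  assumes "submodular_on N f" "C \<subseteq> N" "finite J" "\<And>i. i \<in> J \<Longrightarrow> S i \<subseteq> N"
    and "disjoint_family_on S J"
  shows "real (card J) * f C + f (C \<union> \<Union>(S ` J)) \<le> f C + (\<Sum>i\<in>J. f (C \<union> S i))"
  using assms(3-5)
proof (induction J rule: finite_induct)
  case empty
  then show ?case by simp
next
  case (insert i J)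
  let ?U = "\<Union>(S ` J)"
  have dis: "S i \<inter> ?U = {}"
    using insert.prems insert.hyps by (fastforce simp: disjoint_family_on_def)
  have "f ((C \<union> S i) \<union> (C \<union> ?U)) + f ((C \<union> S i) \<inter> (C \<union> ?U)) \<le> f (C \<union> S i) + f (C \<union> ?U)"
    using insert.prems assms(2) by (intro submodular_onD[OF assms(1)]) auto
  moreover have "(C \<union> S i) \<union> (C \<union> ?U) = C \<union> \<Union>(S ` insert i J)" "(C \<union> S i) \<inter> (C \<union> ?U) = C"
    using dis by auto
  moreover have "real (card J) * f C + f (C \<union> ?U) \<le> f C + (\<Sum>i\<in>J. f (C \<union> S i))"
    using insert.prems by (intro insert.IH) (auto simp: disjoint_family_on_def)
  ultimately show ?case using insert.hyps by (simp add: algebra_simps)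
qed

lemma k_system_card_blocked:
  assumes "finite N" "k_system N \<I> k" "X \<in> \<I>" "A \<in> \<I>"
    and "\<And>w. w \<in> A - X \<Longrightarrow> X \<union> {w} \<notin> \<I>"
  shows "real (card A) \<le> k * real (card X)"
proof -
  have ind: "independence_system N \<I>"
    using assms(2) by (simp add: k_system_def)
  then have sub: "\<I> \<subseteq> Pow N" by (simp add: independence_system_def)
  let ?Y = "X \<union> A"
  have Y: "?Y \<subseteq> N" using sub assms by auto
  then have finY: "finite ?Y" using assms(1) finite_subset by blast
  have "\<exists>m\<in>{B \<in> \<I>. B \<subseteq> ?Y}. A \<subseteq> m \<and> (\<forall>b\<in>{B \<in> \<I>. B \<subseteq> ?Y}. m \<subseteq> b \<longrightarrow> m = b)"
    using finY assms(4) by (intro finite_has_maximal2) auto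
  then obtain B where B: "B \<in> \<I>" "B \<subseteq> ?Y" "A \<subseteq> B"
    and max: "\<And>B'. B' \<in> \<I> \<Longrightarrow> B' \<subseteq> ?Y \<Longrightarrow> B \<subseteq> B' \<Longrightarrow> B = B'"
    by auto
  have "B \<union> {w} \<notin> \<I>" if "w \<in> ?Y - B" for w
    using max[of "B \<union> {w}"] that B by auto
  then have "base_of \<I> B ?Y" using B by (auto simp: base_of_def)
  moreover have "base_of \<I> X ?Y" using assms(3,5) by (auto simp: base_of_def)
  ultimately have "real (card B) \<le> k * real (card X)"
    using assms(2) Y unfolding k_system_def by blast
  moreover have "card A \<le> card B"
    using B finY by (meson card_mono finite_subset)
  ultimately show ?thesis by linarith
qed

lemma greedy_choiceD:
  assumes "greedy_choice f \<I> l S P i u"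
  shows "i \<in> {1..l}" "u \<in> candidates \<I> P (S i)"
    and "\<And>j w. j \<in> {1..l} \<Longrightarrow> w \<in> candidates \<I> P (S j) \<Longrightarrow> marginal f w (S j) \<le> marginal f u (S i)"
proof -
  obtain v where v: "\<forall>j\<in>{1..l}. candidates \<I> P (S j) \<noteq> {} \<longrightarrow>
        is_arg_max (\<lambda>w. marginal f w (S j)) (\<lambda>w. w \<in> candidates \<I> P (S j)) (v j)"
    and i: "is_arg_max (\<lambda>j. marginal f (v j) (S j))
       (\<lambda>j. j \<in> {1..l} \<and> candidates \<I> P (S j) \<noteq> {}) i" and u: "u = v i"
    using assms unfolding greedy_choice_def by blast
  show il: "i \<in> {1..l}" using i by (simp add: is_arg_max_def)
  show "u \<in> candidates \<I> P (S i)" using i v il u by (simp add: is_arg_max_def)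
  fix j w assume j: "j \<in> {1..l}" and w: "w \<in> candidates \<I> P (S j)"
  have "marginal f w (S j) \<le> marginal f (v j) (S j)"
    using v j w by (fastforce simp: is_arg_max_def not_less)
  also have "\<dots> \<le> marginal f u (S i)"
    using i j w u by (fastforce simp: is_arg_max_def not_less)
  finally show "marginal f w (S j) \<le> marginal f u (S i)" .
qed

lemma best_solution_ge_average:
  assumes "best_solution f l S X"
  shows "(\<Sum>i\<in>{1..l}. f (S i)) \<le> real l * f X"
proof -
  have "f (S i) \<le> f X" if "i \<in> {1..l}" for i
    using assms that by (fastforce simp: best_solution_def is_arg_max_def not_less)
  then have "(\<Sum>i\<in>{1..l}. f (S i)) \<le> real (card {1..l}) * f X"
    by (intro sum_bounded_above)
  then show ?thesis by simp
qed

lemma expectation_bernoulli_mixture: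
  fixes f :: "'a \<Rightarrow> real"
  assumes "finite (set_pmf D1)" "finite (set_pmf D0)" "0 \<le> p" "p \<le> 1"
  shows "measure_pmf.expectation (bind_pmf (bernoulli_pmf p) (\<lambda>b. if b then D1 else D0)) f
    = p * measure_pmf.expectation D1 f + (1 - p) * measure_pmf.expectation D0 f"
proof -
  have "measure_pmf.expectation (bind_pmf (bernoulli_pmf p) (\<lambda>b. if b then D1 else D0)) f
    = (\<Sum>b\<in>UNIV. pmf (bernoulli_pmf p) b *\<^sub>R measure_pmf.expectation (if b then D1 else D0) f)"
    using assms by (intro pmf_expectation_bind) auto
  then show ?thesis using assms by (simp add: UNIV_bool)
qed

locale k_system_maximization =
  fixes N :: "'a set" and f :: "'a set \<Rightarrow> real" and \<I> :: "'a set set" and k :: real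
    and opt :: "'a set"
  assumes finite_ground: "finite N"
    and nonneg: "\<And>X. X \<subseteq> N \<Longrightarrow> 0 \<le> f X"
    and submod: "submodular_on N f"
    and ksys: "k_system N \<I> k"
    and opt_indep: "opt \<in> \<I>"
begin

lemma indep_subset_ground: "X \<in> \<I> \<Longrightarrow> X \<subseteq> N"
  using ksys by (auto simp: k_system_def independence_system_def)

lemma indep_subset: "Y \<in> \<I> \<Longrightarrow> X \<subseteq> Y \<Longrightarrow> X \<in> \<I>"
  using ksys unfolding k_system_def independence_system_def by blast

lemma opt_subset: "opt \<subseteq> N"
  by (rule indep_subset_ground[OF opt_indep])

lemma finite_opt: "finite opt"
  using opt_subset finite_ground finite_subset by blast

definition spent :: "'a set \<Rightarrow> 'a set" where
  "spent X = {w \<in> opt. w \<in> X \<or> X \<union> {w} \<notin> \<I>}"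

definition credit :: "'a set \<Rightarrow> real" where
  "credit X = k * real (card X) - real (card (spent X))"

definition settled :: "'a set \<Rightarrow> 'a set \<Rightarrow> 'a set" where
  "settled P X = {w \<in> opt - X. w \<notin> P \<or> X \<union> {w} \<notin> \<I>}"

text \<open>\<open>m\<close> is the gain of the last addition to \<open>X\<close> and \<open>b\<close> the cost so far of the elements of \<open>opt\<close> that
  were considered while they fitted into \<open>X\<close>. The unused capacity \<open>credit X\<close> is valued at \<open>m\<close>, which
  makes the inequality inductive: later gains are smaller, so this capacity pays for elements that are
  blocked later.\<close>

definition charged :: "'a set \<Rightarrow> 'a set \<Rightarrow> real \<Rightarrow> real \<Rightarrow> bool" where
  "charged P X m b \<longleftrightarrow> X \<in> \<I> \<and> X \<inter> P = {} \<and> 0 \<le> m \<and>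
     (\<forall>w\<in>candidates \<I> P X. marginal f w X \<le> m) \<and>
     (\<Sum>w\<in>settled P X. marginal f w X) \<le> k * (f X - f {}) - credit X * m + b"

lemma credit_nonneg:
  assumes "X \<in> \<I>" shows "0 \<le> credit X"
proof -
  have "real (card (spent X)) \<le> k * real (card X)"
    using assms indep_subset[OF opt_indep, of "spent X"]
    by (intro k_system_card_blocked[OF finite_ground ksys]) (auto simp: spent_def)
  then show ?thesis by (simp add: credit_def)
qed

lemma charged_empty:
  assumes "P \<subseteq> N" "opt \<subseteq> P"
  shows "\<exists>m. charged P {} m 0"
proof -
  define m where "m = (\<Sum>w\<in>N. \<bar>marginal f w {}\<bar>)"
  have "marginal f w {} \<le> m" if "w \<in> P" for w
    using member_le_sum[of w N "\<lambda>w. \<bar>marginal f w {}\<bar>"] that assms finite_ground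
    unfolding m_def by fastforce
  moreover have "0 \<le> m" by (simp add: m_def sum_nonneg)
  moreover have "{w} \<in> \<I>" if "w \<in> opt" for w
    using that by (intro indep_subset[OF opt_indep]) auto
  then have "settled P {} = {}" "spent {} = {}"
    using assms by (auto simp: settled_def spent_def)
  moreover have "{} \<in> \<I>" by (rule indep_subset[OF opt_indep]) simp
  ultimately have "charged P {} m 0"
    by (auto simp: charged_def credit_def candidates_def)
  then show ?thesis ..
qed

lemma charged_add:
  assumes ch: "charged P X m b" and P: "P \<subseteq> N" and u: "u \<in> candidates \<I> P X"
    and pos: "0 < marginal f u X"
    and max: "\<And>w. w \<in> candidates \<I> P X \<Longrightarrow> marginal f w X \<le> marginal f u X"
  shows "charged (P - {u}) (X \<union> {u}) (marginal f u X)
    (b - (if u \<in> opt then marginal f u X else 0))"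
proof -
  let ?\<delta> = "marginal f u X" and ?X = "X \<union> {u}" and ?P = "P - {u}"
  let ?e = "if u \<in> opt then 1 else (0::nat)"
  have XI: "X \<in> \<I>" and dis: "X \<inter> P = {}" and XI': "?X \<in> \<I>" and uP: "u \<in> P" "u \<notin> X"
    using ch u by (auto simp: charged_def candidates_def)
  have XN: "?X \<subseteq> N" using XI' indep_subset_ground by blast
  have dec: "marginal f w ?X \<le> marginal f w X" if "w \<in> N - ?X" for w
    using that XN by (intro marginal_antimono[OF submod]) auto
  have cand: "w \<in> candidates \<I> P X" if "w \<in> candidates \<I> ?P ?X" for w
    using that indep_subset[of "?X \<union> {w}" "X \<union> {w}"] by (auto simp: candidates_def)
  have bound: "marginal f w ?X \<le> ?\<delta>" if "w \<in> candidates \<I> ?P ?X" for w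
  proof -
    have "w \<in> N - ?X" using that P dis by (auto simp: candidates_def)
    then show ?thesis using dec[of w] max[OF cand[OF that]] by linarith
  qed

  define new where "new = settled ?P ?X - settled P X"
  have fin: "finite (settled P X)" "finite (settled ?P ?X)" "finite (spent X)" "finite (spent ?X)"
    using finite_opt by (auto simp: settled_def spent_def)
  have old_sub: "settled P X \<subseteq> settled ?P ?X"
  proof
    fix w assume w: "w \<in> settled P X"
    then have "w \<noteq> u" using u by (auto simp: settled_def candidates_def)
    then show "w \<in> settled ?P ?X"
      using w indep_subset[of "?X \<union> {w}" "X \<union> {w}"] by (auto simp: settled_def)
  qed
  have new: "w \<in> candidates \<I> P X \<and> w \<in> opt \<and> w \<notin> ?X \<and> ?X \<union> {w} \<notin> \<I>" if "w \<in> new" for w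
    using that by (auto simp: new_def settled_def candidates_def)
  have "(\<Sum>w\<in>settled ?P ?X. marginal f w ?X)
      = (\<Sum>w\<in>settled P X. marginal f w ?X) + (\<Sum>w\<in>new. marginal f w ?X)"
    unfolding new_def by (subst sum.subset_diff[OF old_sub fin(2)]) (rule add.commute)
  also have "(\<Sum>w\<in>settled P X. marginal f w ?X) \<le> (\<Sum>w\<in>settled P X. marginal f w X)"
    using old_sub opt_subset by (intro sum_mono dec) (auto simp: settled_def)
  also have "(\<Sum>w\<in>new. marginal f w ?X) \<le> real (card new) * ?\<delta>"
  proof (rule sum_bounded_above)
    fix w assume "w \<in> new"
    then show "marginal f w ?X \<le> ?\<delta>"
      using dec[of w] max[of w] new[of w] opt_subset by force
  qed
  finally have W: "(\<Sum>w\<in>settled ?P ?X. marginal f w ?X)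
      \<le> k * (f X - f {}) - credit X * m + b + real (card new) * ?\<delta>"
    using ch by (simp add: charged_def)

  have "card (spent X) + card new + ?e \<le> card (spent ?X)"
  proof -
    let ?E = "opt \<inter> {u}"
    have "spent X \<union> new \<union> ?E \<subseteq> spent ?X"
    proof -
      have "X \<union> {w} \<in> \<I>" if "?X \<union> {w} \<in> \<I>" for w
        using that by (rule indep_subset) auto
      then show ?thesis using new by (auto simp: spent_def)
    qed
    then have "card (spent X \<union> new \<union> ?E) \<le> card (spent ?X)"
      using fin card_mono by blast
    moreover have "card (spent X \<union> new \<union> ?E) = card (spent X) + card new + card ?E"
    proof -
      have "finite new" using fin by (simp add: new_def)
      moreover have "spent X \<inter> new = {}"
        using new by (auto simp: spent_def candidates_def)
      moreover have "(spent X \<union> new) \<inter> ?E = {}"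
        using new uP XI' by (auto simp: spent_def)
      ultimately show ?thesis using fin by (simp add: card_Un_disjoint)
    qed
    moreover have "card ?E = ?e" by auto
    ultimately show ?thesis by linarith
  qed
  then have c: "real (card new) \<le> credit X + k - credit ?X - real ?e"
    using uP finite_subset[OF indep_subset_ground[OF XI] finite_ground]
    by (simp add: credit_def algebra_simps)
  have "credit X * ?\<delta> \<le> credit X * m"
    using ch u by (intro mult_left_mono credit_nonneg XI) (auto simp: charged_def)
  moreover have "real (card new) * ?\<delta> \<le> (credit X + k - credit ?X - real ?e) * ?\<delta>"
    using c pos by (intro mult_right_mono) auto
  moreover have "real ?e * ?\<delta> = (if u \<in> opt then ?\<delta> else 0)" by simp
  moreover have "f ?X = f X + ?\<delta>" by (simp add: marginal_def)
  ultimately have "(\<Sum>w\<in>settled ?P ?X. marginal f w ?X)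
      \<le> k * (f ?X - f {}) - credit ?X * ?\<delta> + (b - (if u \<in> opt then ?\<delta> else 0))"
    using W by (simp add: algebra_simps)
  then show ?thesis
    unfolding charged_def using XI' dis pos bound by auto
qed

lemma charged_skip:
  assumes ch: "charged P X m b" and "0 \<le> d"
    and max: "\<And>w. w \<in> candidates \<I> P X \<Longrightarrow> marginal f w X \<le> d"
  shows "charged (P - {u}) X m (b + (if u \<in> opt then d else 0))"
proof -
  have fin: "finite (settled P X)" using finite_opt by (auto simp: settled_def)
  have "(\<Sum>w\<in>settled (P - {u}) X. marginal f w X)
    \<le> (\<Sum>w\<in>settled P X. marginal f w X) + (if u \<in> opt then d else 0)"
  proof (cases "u \<in> opt - X - settled P X")
    case True
    then have "settled (P - {u}) X = insert u (settled P X)" "u \<in> candidates \<I> P X"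
      by (auto simp: settled_def candidates_def)
    then show ?thesis using True fin max by simp
  next
    case False
    then have "settled (P - {u}) X = settled P X"
      by (auto simp: settled_def)
    then show ?thesis using assms(2) by simp
  qed
  then show ?thesis
    using ch by (auto simp: charged_def candidates_def)
qed

lemma charged_final:
  assumes ch: "charged P X m b"
    and max: "\<And>w. w \<in> candidates \<I> P X \<Longrightarrow> marginal f w X \<le> 0"
  shows "f (opt \<union> X) - f X \<le> k * (f X - f {}) + b"
proof -
  have XI: "X \<in> \<I>" using ch by (simp add: charged_def)
  have "f (X \<union> (opt - X)) - f X \<le> (\<Sum>w\<in>opt - X. marginal f w X)"
    using finite_opt opt_subset indep_subset_ground[OF XI]
    by (intro union_gain_le_sum_marginal[OF submod]) auto
  also have "\<dots> = (\<Sum>w\<in>settled P X. marginal f w X) + (\<Sum>w\<in>opt - X - settled P X. marginal f w X)"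
    using finite_opt by (subst sum.subset_diff[of "settled P X"]) (auto simp: settled_def)
  also have "(\<Sum>w\<in>opt - X - settled P X. marginal f w X) \<le> 0"
    by (intro sum_nonpos max) (auto simp: settled_def candidates_def)
  also have "(\<Sum>w\<in>settled P X. marginal f w X) \<le> k * (f X - f {}) - credit X * m + b"
    using ch by (simp add: charged_def)
  also have "\<dots> \<le> k * (f X - f {}) + b"
    using ch credit_nonneg[OF XI] by (simp add: charged_def)
  finally show ?thesis by (simp add: Un_commute)
qed

definition state_inv ::
    "nat \<Rightarrow> (nat \<Rightarrow> 'a set) \<Rightarrow> 'a set \<Rightarrow> (nat \<Rightarrow> real) \<Rightarrow> (nat \<Rightarrow> real) \<Rightarrow> bool" where
  "state_inv l S P M a \<longleftrightarrow> P \<subseteq> N \<and> disjoint_family_on S {1..l} \<and>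
     (\<forall>i\<in>{1..l}. charged P (S i) (M i) (a i))"

lemma state_inv_add:
  assumes inv: "state_inv l S P M a" and g: "greedy_choice f \<I> l S P i u"
    and pos: "0 < marginal f u (S i)"
  shows "state_inv l (S(i := S i \<union> {u})) (P - {u}) (M(i := marginal f u (S i)))
    (\<lambda>j. a j + (if u \<in> opt then if j = i then - marginal f u (S i) else marginal f u (S i) else 0))"
proof -
  note g' = greedy_choiceD[OF g]
  have "u \<notin> S j" if "j \<in> {1..l}" for j
    using inv that g'(2) by (auto simp: state_inv_def charged_def candidates_def)
  then have "disjoint_family_on (S(i := S i \<union> {u})) {1..l}"
    using inv g'(1) by (auto simp: state_inv_def disjoint_family_on_def)
  moreover have "charged (P - {u}) (S i \<union> {u}) (marginal f u (S i))
      (a i - (if u \<in> opt then marginal f u (S i) else 0))"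
    using inv g' pos by (intro charged_add) (auto simp: state_inv_def)
  moreover have "charged (P - {u}) (S j) (M j) (a j + (if u \<in> opt then marginal f u (S i) else 0))"
    if "j \<in> {1..l}" for j
    using inv g' pos that by (intro charged_skip) (auto simp: state_inv_def)
  ultimately show ?thesis
    using inv by (auto simp: state_inv_def split: if_splits)
qed

lemma state_inv_discard:
  assumes inv: "state_inv l S P M a" and g: "greedy_choice f \<I> l S P i u"
    and pos: "0 < marginal f u (S i)"
  shows "state_inv l S (P - {u}) M (\<lambda>j. a j + (if u \<in> opt then marginal f u (S i) else 0))"
proof -
  note g' = greedy_choiceD[OF g]
  have "charged (P - {u}) (S j) (M j) (a j + (if u \<in> opt then marginal f u (S i) else 0))"
    if "j \<in> {1..l}" for j
    using inv g' pos that by (intro charged_skip) (auto simp: state_inv_def)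
  then show ?thesis using inv by (auto simp: state_inv_def)
qed

text \<open>\<open>T\<close> cannot be replaced by the whole pool \<open>P\<close>, since the algorithm may stop before considering all
  of it. The terms with weights \<open>1 - p\<close> and \<open>p\<close> bound the expectation of \<open>f (opt \<union> R)\<close> for the final \<open>R\<close>;
  the multiple of \<open>\<Sum> f (S i)\<close> accounts for the expected future growth of \<open>a\<close>.\<close>

definition guarantee ::
    "nat \<Rightarrow> real \<Rightarrow> (nat \<Rightarrow> 'a set) \<Rightarrow> 'a set \<Rightarrow> (nat \<Rightarrow> real) \<Rightarrow> 'a set pmf \<Rightarrow> bool" where
  "guarantee l p S P a D \<longleftrightarrow> (\<exists>T\<subseteq>P.
     (real l - 1) * f opt + (1 - p) * f (opt \<union> \<Union>(S ` {1..l}))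
       + p * f (opt \<union> \<Union>(S ` {1..l}) \<union> T)
     \<le> (k + real l / p - 1) * (real l * measure_pmf.expectation D f)
       - (real l / p - 2) * (\<Sum>i\<in>{1..l}. f (S i)) - k * real l * f {} + (\<Sum>i\<in>{1..l}. a i))"

lemma guarantee_final:
  assumes inv: "state_inv l S P M a" and best: "best_solution f l S X"
    and max: "\<And>i w. i \<in> {1..l} \<Longrightarrow> w \<in> candidates \<I> P (S i) \<Longrightarrow> marginal f w (S i) \<le> 0"
    and l: "2 \<le> l" and p: "0 < p" "p \<le> 1"
  shows "set_pmf (return_pmf X) \<subseteq> \<I> \<and> guarantee l p S P a (return_pmf X)"
proof -
  let ?R = "\<Union>(S ` {1..l})" and ?F = "\<Sum>i\<in>{1..l}. f (S i)"
  have SI: "S i \<in> \<I>" if "i \<in> {1..l}" for i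
    using inv that by (simp add: state_inv_def charged_def)
  have k: "1 \<le> k" using ksys by (simp add: k_system_def)
  have "X \<in> \<I>" using best SI by (auto simp: best_solution_def is_arg_max_def)
  have "real (card {1..l}) * f opt + f (opt \<union> ?R) \<le> f opt + (\<Sum>i\<in>{1..l}. f (opt \<union> S i))"
    using SI inv indep_subset_ground
    by (intro submodular_disjoint_family[OF submod opt_subset]) (auto simp: state_inv_def)
  moreover have "(\<Sum>i\<in>{1..l}. f (opt \<union> S i)) \<le> (\<Sum>i\<in>{1..l}. (k + 1) * f (S i) - k * f {} + a i)"
  proof (rule sum_mono)
    fix i assume i: "i \<in> {1..l}"
    then have "charged P (S i) (M i) (a i)" using inv by (simp add: state_inv_def)
    from charged_final[OF this max[OF i]]
    show "f (opt \<union> S i) \<le> (k + 1) * f (S i) - k * f {} + a i"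
      by (simp add: algebra_simps)
  qed
  moreover have "\<dots> = (k + 1) * ?F - k * real l * f {} + (\<Sum>i\<in>{1..l}. a i)"
    by (simp add: sum.distrib sum_subtractf sum_distrib_left)
  ultimately have A: "(real l - 1) * f opt + f (opt \<union> ?R)
      \<le> (k + 1) * ?F - k * real l * f {} + (\<Sum>i\<in>{1..l}. a i)"
    by (simp add: algebra_simps)
  have "2 * p \<le> real l" using l p by linarith
  then have "2 \<le> real l / p" using p by (simp add: field_simps)
  then have "(k + real l / p - 1) * ?F \<le> (k + real l / p - 1) * (real l * f X)"
    using k best_solution_ge_average[OF best] by (intro mult_left_mono) auto
  with A have "guarantee l p S P a (return_pmf X)"
    unfolding guarantee_def by (intro exI[of _ "{}"]) (simp add: algebra_simps)
  then show ?thesis using \<open>X \<in> \<I>\<close> by simp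
qed

lemma guarantee_step:
  assumes inv: "state_inv l S P M a" and g: "greedy_choice f \<I> l S P i u"
    and pos: "0 < marginal f u (S i)"
    and l: "2 \<le> l" and p: "0 < p" "p \<le> 1"
    and fin: "finite (set_pmf D1)" "finite (set_pmf D0)"
    and G1: "guarantee l p (S(i := S i \<union> {u})) (P - {u})
      (\<lambda>j. a j + (if u \<in> opt then if j = i then - marginal f u (S i) else marginal f u (S i) else 0)) D1"
    and G0: "guarantee l p S (P - {u}) (\<lambda>j. a j + (if u \<in> opt then marginal f u (S i) else 0)) D0"
  shows "guarantee l p S P a (bind_pmf (bernoulli_pmf p) (\<lambda>b. if b then D1 else D0))"
proof -
  let ?d = "marginal f u (S i)" and ?S = "S(i := S i \<union> {u})"
  let ?R = "opt \<union> \<Union>(S ` {1..l})" and ?F = "\<Sum>j\<in>{1..l}. f (S j)" and ?A = "\<Sum>j\<in>{1..l}. a j"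
  let ?e = "if u \<in> opt then ?d else 0"
  let ?c = "k + real l / p - 1"
  let ?D = "bind_pmf (bernoulli_pmf p) (\<lambda>b. if b then D1 else D0)"
  note g' = greedy_choiceD[OF g]
  have i: "i \<in> {1..l}" by (rule g'(1))
  have uP: "u \<in> P" using g'(2) by (simp add: candidates_def)
  have PN: "P \<subseteq> N" using inv by (simp add: state_inv_def)
  have RN: "?R \<subseteq> N"
    using inv opt_subset indep_subset_ground by (auto simp: state_inv_def charged_def)
  have R1: "opt \<union> \<Union>(?S ` {1..l}) = ?R \<union> {u}" using i by (auto split: if_splits)
  have F1: "(\<Sum>j\<in>{1..l}. f (?S j)) = ?F + ?d"
    using i by (simp add: sum.remove[of _ i] marginal_def)
  have A1: "(\<Sum>j\<in>{1..l}. a j + (if u \<in> opt then if j = i then - ?d else ?d else 0)) = ?A + (real l - 2) * ?e"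
  proof -
    have "(\<Sum>j\<in>{1..l}. if u \<in> opt then if j = i then - ?d else ?d else 0)
      = (\<Sum>j\<in>{1..l}. ?e - (if j = i then 2 * ?e else 0))"
      by (intro sum.cong) auto
    also have "\<dots> = (real l - 2) * ?e"
      using i by (simp add: sum_subtractf algebra_simps)
    finally show ?thesis by (simp add: sum.distrib)
  qed
  have A0: "(\<Sum>j\<in>{1..l}. a j + ?e) = ?A + real l * ?e" by (simp add: sum.distrib)

  obtain T1 where T1: "T1 \<subseteq> P - {u}" and I1: "(real l - 1) * f opt + (1 - p) * f (?R \<union> {u}) + p * f (?R \<union> {u} \<union> T1)
     \<le> ?c * (real l * measure_pmf.expectation D1 f)
       - (real l / p - 2) * (?F + ?d) - k * real l * f {} + (?A + (real l - 2) * ?e)"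
    using G1 unfolding guarantee_def R1 F1 A1 by blast
  obtain T0 where T0: "T0 \<subseteq> P - {u}" and I0: "(real l - 1) * f opt + (1 - p) * f ?R + p * f (?R \<union> T0)
     \<le> ?c * (real l * measure_pmf.expectation D0 f)
       - (real l / p - 2) * ?F - k * real l * f {} + (?A + real l * ?e)"
    using G0 unfolding guarantee_def A0 by blast
  have sub: "f (?R \<union> {u} \<union> T0) + f ?R \<le> f (?R \<union> {u}) + f (?R \<union> T0)"
  proof (cases "u \<in> ?R")
    case True
    then have "?R \<union> {u} = ?R" by blast
    then show ?thesis by simp
  next
    case False
    then have "marginal f u (?R \<union> T0) \<le> marginal f u ?R"
      using T0 PN RN uP by (intro marginal_antimono[OF submod]) auto
    moreover have "?R \<union> T0 \<union> {u} = ?R \<union> {u} \<union> T0" by blast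
    ultimately show ?thesis by (simp add: marginal_def)
  qed
  obtain T where T: "T \<subseteq> P" "f (?R \<union> T) \<le> p * f (?R \<union> {u} \<union> T1) + (1 - p) * f (?R \<union> {u} \<union> T0)"
  proof -
    let ?t1 = "f (?R \<union> {u} \<union> T1)" and ?t0 = "f (?R \<union> {u} \<union> T0)"
    have e: "?R \<union> ({u} \<union> T') = ?R \<union> {u} \<union> T'" for T' by blast
    show ?thesis
    proof (cases "?t1 \<le> ?t0")
      case True
      then have "(1 - p) * ?t1 \<le> (1 - p) * ?t0" using p by (intro mult_left_mono) auto
      then show ?thesis using T1 uP that[of "{u} \<union> T1"] unfolding e by (auto simp: algebra_simps)
    next
      case False
      then have "p * ?t0 \<le> p * ?t1" using p by (intro mult_left_mono) auto
      then show ?thesis using T0 uP that[of "{u} \<union> T0"] unfolding e by (auto simp: algebra_simps)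
    qed
  qed
  have E: "measure_pmf.expectation ?D f
      = p * measure_pmf.expectation D1 f + (1 - p) * measure_pmf.expectation D0 f"
    using fin p by (intro expectation_bernoulli_mixture) auto

  define r ru t1 t0 tu t where "r = f ?R" and "ru = f (?R \<union> {u})" and "t1 = f (?R \<union> {u} \<union> T1)"
    and "t0 = f (?R \<union> T0)" and "tu = f (?R \<union> {u} \<union> T0)" and "t = f (?R \<union> T)"
  note defs = r_def[symmetric] ru_def[symmetric] t1_def[symmetric] t0_def[symmetric]
    tu_def[symmetric] t_def[symmetric]
  define d where "d = ?d"
  define q E1 E0 F A K B e where "q = real l / p" and "E1 = measure_pmf.expectation D1 f"
    and "E0 = measure_pmf.expectation D0 f"
    and "F = ?F" and "A = ?A" and "K = k * real l * f {}" and "B = (real l - 1) * f opt"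
    and "e = (if u \<in> opt then d else 0)"
  note defs = defs q_def[symmetric] E1_def[symmetric] E0_def[symmetric] F_def[symmetric]
    A_def[symmetric] K_def[symmetric] B_def[symmetric] d_def[symmetric] e_def[symmetric]
  have lp: "real l = p * q" using p by (simp add: q_def)
  have I1': "p * (B + (1 - p) * ru + p * t1)
      \<le> p * ((k + q - 1) * (real l * E1) - (q - 2) * (F + d) - K + (A + (real l - 2) * e))"
    using I1 p unfolding defs by (intro mult_left_mono) auto
  have I0': "(1 - p) * (B + (1 - p) * r + p * t0)
      \<le> (1 - p) * ((k + q - 1) * (real l * E0) - (q - 2) * F - K + (A + real l * e))"
    using I0 p unfolding defs by (intro mult_left_mono) auto
  have s: "p * (1 - p) * (tu + r) \<le> p * (1 - p) * (ru + t0)"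
    using sub p unfolding defs by (intro mult_left_mono) auto
  have t: "p * t \<le> p * (p * t1 + (1 - p) * tu)"
    using T(2) p unfolding defs by (intro mult_left_mono) auto
  have ed: "(real l - 2 * p) * e \<le> (real l - 2 * p) * d"
    using pos l p unfolding e_def d_def by (intro mult_left_mono) auto
  have "B + (1 - p) * r + p * t \<le> p * (B + (1 - p) * ru + p * t1) + (1 - p) * (B + (1 - p) * r + p * t0)"
    using s t by (simp add: algebra_simps)
  also have "\<dots> \<le> (k + q - 1) * (real l * (p * E1 + (1 - p) * E0)) - (q - 2) * F - K + A
      + ((real l - 2 * p) * e - p * (q - 2) * d)"
    using I1' I0' by (simp add: algebra_simps)
  also have "\<dots> \<le> (k + q - 1) * (real l * (p * E1 + (1 - p) * E0)) - (q - 2) * F - K + A"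
    using ed lp by (simp add: algebra_simps)
  finally show ?thesis
    unfolding guarantee_def E defs using T(1) t_def by blast
qed

lemma rmg_from_guarantee:
  assumes "rmg_from f \<I> l p S P D" "state_inv l S P M a"
    and l: "2 \<le> l" and p: "0 < p" "p \<le> 1"
  shows "set_pmf D \<subseteq> \<I> \<and> guarantee l p S P a D"
  using assms(1,2)
proof (induction arbitrary: M a rule: rmg_from.induct)
  case (stop_pool P S X)
  then show ?case by (intro guarantee_final l p) (auto simp: candidates_def)
next
  case (stop_infeasible P S X)
  then show ?case by (intro guarantee_final l p) auto
next
  case (stop_gain S P i u X)
  then show ?case
    using greedy_choiceD(3)[OF stop_gain(1)] by (intro guarantee_final l p) force+
next
  case (step S P i u D1 D0)
  note D1 = step.IH(1)[OF state_inv_add[OF step.prems step.hyps(1,2)]]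
  note D0 = step.IH(2)[OF state_inv_discard[OF step.prems step.hyps(1,2)]]
  have "finite \<I>"
    using indep_subset_ground finite_ground by (meson Pow_iff finite_Pow_iff finite_subset subsetI)
  then have "finite (set_pmf D1)" "finite (set_pmf D0)"
    using D1 D0 finite_subset by auto
  with D1 D0 have "guarantee l p S P a (bind_pmf (bernoulli_pmf p) (\<lambda>b. if b then D1 else D0))"
    by (intro guarantee_step[OF step.prems step.hyps(1,2) l p]) blast+
  then show ?case using D1 D0 by (auto split: if_splits)
qed

end

theorem theorem1:
  fixes N :: "'a set" and f :: "'a set \<Rightarrow> real" and \<I> :: "'a set set"
    and k p :: real and l :: nat and opt :: "'a set" and D :: "'a set pmf"
  assumes "finite N"
    and "\<And>X. X \<subseteq> N \<Longrightarrow> 0 \<le> f X"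
    and "submodular_on N f"
    and "k_system N \<I> k"
    and "is_arg_max f (\<lambda>X. X \<in> \<I>) opt"
    and "2 \<le> l"
    and "0 < p" and "p \<le> 1"
    and "random_multi_greedy N f \<I> l p D"
  shows "(\<forall>X\<in>set_pmf D. X \<in> \<I>) \<and>
    f opt \<le> real l * (k + real l / p - 1) / (real l - p) * measure_pmf.expectation D f"
proof -
  interpret k_system_maximization N f \<I> k opt
    using assms by unfold_locales (auto simp: is_arg_max_def)
  let ?E = "measure_pmf.expectation D f"
  obtain m where "charged N {} m 0" using charged_empty[OF order_refl opt_subset] ..
  then have "state_inv l (\<lambda>i. {}) N (\<lambda>i. m) (\<lambda>i. 0)"
    by (simp add: state_inv_def disjoint_family_on_def)
  from rmg_from_guarantee[OF _ this assms(6-8)] assms(9)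
  have D: "set_pmf D \<subseteq> \<I>" and "guarantee l p (\<lambda>i. {}) N (\<lambda>i. 0) D"
    by (auto simp: random_multi_greedy_def)
  then obtain T where T: "T \<subseteq> N" "(real l - 1) * f opt + (1 - p) * f opt + p * f (opt \<union> T)
     \<le> (k + real l / p - 1) * (real l * ?E) - (real l / p - 2) * (real l * f {}) - k * real l * f {}"
    by (auto simp: guarantee_def)
  have k: "1 \<le> k" using assms(4) by (simp add: k_system_def)
  have "2 * p \<le> real l" using assms(6-8) by linarith
  then have "2 \<le> real l / p" using assms(7) by (simp add: field_simps)
  then have "0 \<le> (real l / p - 2) * (real l * f {})" "0 \<le> k * real l * f {}"
    using k nonneg[of "{}"] by auto
  moreover have "0 \<le> p * f (opt \<union> T)" using nonneg opt_subset T assms(7) by auto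
  ultimately have "f opt * (real l - p) \<le> real l * (k + real l / p - 1) * ?E"
    using T(2) by (simp add: algebra_simps)
  moreover have "0 < real l - p" using assms(6,8) by linarith
  ultimately have "f opt \<le> real l * (k + real l / p - 1) / (real l - p) * ?E"
    by (simp add: pos_le_divide_eq)
  then show ?thesis using D by auto
qed

end
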